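(* Let $A,B,K\in\mathbb{R}^{2\times2}$ with $B$ invertible, let $G(\mathbf{x})=B^\top B$, and let $h(\mathbf{x})=\|\mathbf{x}-\mathbf{x}_c\|^2-r^2$ with $\mathbf{x}_c\in\mathbb{R}^2$, $r>0$ and $h(\mathbf{0}_2)>0$. Suppose $\tilde A:=A-BK$ is Hurwitz with two real eigenvalues $\lambda_1<\lambda_2$ and $\mathbf{x}_c$ is not an eigenvector of $\tilde A$. Then the filtered system $\dot{\mathbf{x}}=\tilde A\mathbf{x}+Bv(\mathbf{x})$ has no undesired equilibrium with indicator $\delta\in\{\frac{\lambda_1}{2},\frac{\lambda_2}{2}\}$. Moreover, if $\mathbf{v}_1,\mathbf{v}_2$ are eigenvectors of $\tilde A$ associated with $\lambda_1,\lambda_2$, respectively, with $\mathbf{v}_1^\top\mathbf{v}_2\ge0$, $\|\mathbf{v}_1\|=\|\mathbf{v}_2\|=1$, and $\mathbf{x}_c=\beta_1\mathbf{v}_1+\beta_2\mathbf{v}_2$, the following holds. (i) If $\beta_1^2+\beta_1\beta_2\mathbf{v}_1^\top\mathbf{v}_2\ge0$, then any undesired equilibrium $\mathbf{x}_*$ with indicator $\delta_{\mathbf{x}_*}<\frac{\lambda_1}{2}$ is a saddle point. (ii) If $\beta_1\beta_2\mathbf{v}_2^\top\mathbf{v}_1+\beta_2^2\ge0$, then any undesired equilibrium $\mathbf{x}_*$ with indicator $\frac{\lambda_2}{2}<\delta_{\mathbf{x}_*}<0$ is asymptotically stable. (iii) Define $F_1:\mathbb{R}\to\mathbb{R}$ by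 $$F_1(\delta)=-|\lambda_1-2\delta|^2|\lambda_2-2\delta|^2r^2+|\lambda_1\beta_1|^2|\lambda_2-2\delta|^2+|\lambda_2\beta_2|^2|\lambda_1-2\delta|^2+\lambda_1^*\beta_1^*\lambda_2\beta_2(\lambda_2-2\delta)^*(\lambda_1-2\delta)\mathbf{v}_1^*\mathbf{v}_2+\lambda_1\beta_1\lambda_2^*\beta_2^*(\lambda_2-2\delta)(\lambda_1-2\delta)^*\mathbf{v}_2^*\mathbf{v}_1.$$ If the third-order polynomial $\frac{dF_1(\delta)}{d\delta}$ has only one real root and $\beta_1^2+\beta_1\beta_2\mathbf{v}_1^\top\mathbf{v}_2\ge0$, then there exists only one undesired equilibrium and it is a saddle point.
   Context: ${}^*$ denotes complex conjugate (transpose); all quantities in $F_1$ are real here, so it may be ignored (for vectors it is the transpose). The nominal controller for $\dot{\mathbf{x}}=A\mathbf{x}+B\mathbf{u}$ is $\mathbf{u}=-K\mathbf{x}$, and the safe set is $\mathcal{C}=\{h\ge0\}$. $\alpha:\mathbb{R}\to\mathbb{R}$ is an extended class $\mathcal{K}_\infty$ function (continuous, strictly increasing, $\alpha(0)=0$, $\lim_{s\to\pm\infty}\alpha(s)=\pm\infty$), differentiable with $\alpha'(0)>0$. With $\eta(\mathbf{x})=\nabla h(\mathbf{x})^\top\tilde A\mathbf{x}+\alpha(h(\mathbf{x}))$, the safety filter is $v(\mathbf{x})=\mathbf{0}$ if $\eta(\mathbf{x})\ge0$ and $v(\mathbf{x})=-\dfrac{\eta(\mathbf{x})G(\mathbf{x})^{-1}B^\top\nabla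 h(\mathbf{x})}{\nabla h(\mathbf{x})^\top BG(\mathbf{x})^{-1}B^\top\nabla h(\mathbf{x})}$ if $\eta(\mathbf{x})<0$. Undesired equilibria are the points $\mathbf{x}_*$ with $h(\mathbf{x}_* )=0$ for which there is $\delta<0$ with $\tilde A\mathbf{x}_*=\delta BG(\mathbf{x}_* )^{-1}B^\top\nabla h(\mathbf{x}_* )$ (equivalently, the equilibria of the filtered system in $\mathcal{C}$ other than the origin); this $\delta=\delta_{\mathbf{x}_*}$ is the indicator of $\mathbf{x}_*$. A saddle point is an equilibrium at which the Jacobian of the closed-loop vector field has one positive and one negative eigenvalue. *)

theory Defs
  imports "HOL-Analysis.Analysis"
begin

subsection \<open>Linear algebra\<close>

definition eigenvector :: "'a::field ^'n ^'n \<Rightarrow> 'a ^'n \<Rightarrow> 'a \<Rightarrow> bool" where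
  "eigenvector M v k \<longleftrightarrow> v \<noteq> 0 \<and> M *v v = k *s v"

definition eigenvalue :: "'a::field ^'n ^'n \<Rightarrow> 'a \<Rightarrow> bool" where
  "eigenvalue M k \<longleftrightarrow> (\<exists>v. eigenvector M v k)"

definition hurwitz :: "real ^'n ^'n \<Rightarrow> bool" where
  "hurwitz M \<longleftrightarrow> (\<forall>z. eigenvalue (map_matrix complex_of_real M) z \<longrightarrow> Re z < 0)"

definition gradient :: "('a::real_inner \<Rightarrow> real) \<Rightarrow> 'a \<Rightarrow> 'a" where
  "gradient f x = (THE D. GDERIV f x :> D)"


subsection \<open>Autonomous systems\<close>

definition solves_on :: "('a::real_normed_vector \<Rightarrow> 'a) \<Rightarrow> (real \<Rightarrow> 'a) \<Rightarrow> real set \<Rightarrow> bool" where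
  "solves_on f x I \<longleftrightarrow> (\<forall>t\<in>I. (x has_vector_derivative f (x t)) (at t within I))"

definition equilibrium :: "('a::real_normed_vector \<Rightarrow> 'a) \<Rightarrow> 'a \<Rightarrow> bool" where
  "equilibrium f p \<longleftrightarrow> f p = 0"

text \<open>The vector field need not be locally Lipschitz, so trajectories from a given initial
  state need not be unique, and the definitions below quantify over all of them. Stability also
  constrains the trajectories on bounded time intervals, so that it cannot hold merely because
  trajectories fail to be defined for all positive times.\<close>

definition lyapunov_stable :: "('a::real_normed_vector \<Rightarrow> 'a) \<Rightarrow> 'a \<Rightarrow> bool" where
  "lyapunov_stable f p \<longleftrightarrow> (\<forall>\<epsilon>>0. \<exists>\<rho>>0. \<forall>x. \<forall>T>0.
     solves_on f x {0..T} \<and> dist (x 0) p < \<rho> \<longrightarrow> (\<forall>t\<in>{0..T}. dist (x t) p < \<epsilon>))"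

definition locally_attractive :: "('a::real_normed_vector \<Rightarrow> 'a) \<Rightarrow> 'a \<Rightarrow> bool" where
  "locally_attractive f p \<longleftrightarrow> (\<exists>\<rho>>0. \<forall>x.
     solves_on f x {0..} \<and> dist (x 0) p < \<rho> \<longrightarrow> (x \<longlongrightarrow> p) at_top)"

definition asymptotically_stable :: "('a::real_normed_vector \<Rightarrow> 'a) \<Rightarrow> 'a \<Rightarrow> bool" where
  "asymptotically_stable f p \<longleftrightarrow>
     equilibrium f p \<and> lyapunov_stable f p \<and> locally_attractive f p"

text \<open>Planar systems only, where one eigenvalue of each sign exhausts the spectrum.\<close>

definition saddle_point :: "(real ^2 \<Rightarrow> real ^2) \<Rightarrow> real ^2 \<Rightarrow> bool" where
  "saddle_point f p \<longleftrightarrow> equilibrium f p \<and>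
     f differentiable (at p) \<and>
     (\<exists>\<mu>>0. eigenvalue (jacobian f (at p)) \<mu>) \<and> (\<exists>\<nu><0. eigenvalue (jacobian f (at p)) \<nu>)"


subsection \<open>Safety filters\<close>

definition extended_class_K_inf :: "(real \<Rightarrow> real) \<Rightarrow> bool" where
  "extended_class_K_inf \<alpha> \<longleftrightarrow> continuous_on UNIV \<alpha> \<and> strict_mono \<alpha> \<and> \<alpha> 0 = 0 \<and>
     filterlim \<alpha> at_top at_top \<and> filterlim \<alpha> at_bot at_bot"

text \<open>Below, \<open>At\<close> is the matrix $A - BK$ of the nominal closed loop.\<close>

definition filter_margin ::
  "real ^'n ^'n \<Rightarrow> (real ^'n \<Rightarrow> real) \<Rightarrow> (real \<Rightarrow> real) \<Rightarrow> real ^'n \<Rightarrow> real" where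
  "filter_margin At h \<alpha> x = gradient h x \<bullet> (At *v x) + \<alpha> (h x)"

definition safety_filter ::
  "real ^'n ^'n \<Rightarrow> real ^'m ^'n \<Rightarrow> (real ^'n \<Rightarrow> real ^'m ^'m) \<Rightarrow> (real ^'n \<Rightarrow> real) \<Rightarrow>
   (real \<Rightarrow> real) \<Rightarrow> real ^'n \<Rightarrow> real ^'m" where
  "safety_filter At B G h \<alpha> x =
     (if filter_margin At h \<alpha> x \<ge> 0 then 0
      else - ((filter_margin At h \<alpha> x /
               (gradient h x \<bullet> ((B ** matrix_inv (G x) ** transpose B) *v gradient h x))) *\<^sub>R
              ((matrix_inv (G x) ** transpose B) *v gradient h x)))"

definition filtered_system ::
  "real ^'n ^'n \<Rightarrow> real ^'m ^'n \<Rightarrow> (real ^'n \<Rightarrow> real ^'m ^'m) \<Rightarrow> (real ^'n \<Rightarrow> real) \<Rightarrow>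
   (real \<Rightarrow> real) \<Rightarrow> real ^'n \<Rightarrow> real ^'n" where
  "filtered_system At B G h \<alpha> x = At *v x + B *v safety_filter At B G h \<alpha> x"

definition undesired_equilibrium_with_indicator ::
  "real ^'n ^'n \<Rightarrow> real ^'m ^'n \<Rightarrow> (real ^'n \<Rightarrow> real ^'m ^'m) \<Rightarrow> (real ^'n \<Rightarrow> real) \<Rightarrow>
   real ^'n \<Rightarrow> real \<Rightarrow> bool" where
  "undesired_equilibrium_with_indicator At B G h x \<delta> \<longleftrightarrow> h x = 0 \<and> \<delta> < 0 \<and>
     At *v x = \<delta> *\<^sub>R ((B ** matrix_inv (G x) ** transpose B) *v gradient h x)"

definition undesired_equilibrium ::
  "real ^'n ^'n \<Rightarrow> real ^'m ^'n \<Rightarrow> (real ^'n \<Rightarrow> real ^'m ^'m) \<Rightarrow> (real ^'n \<Rightarrow> real) \<Rightarrow>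
   real ^'n \<Rightarrow> bool" where
  "undesired_equilibrium At B G h x \<longleftrightarrow>
     (\<exists>\<delta>. undesired_equilibrium_with_indicator At B G h x \<delta>)"

text \<open>All quantities are real, so the complex conjugations in the formula are omitted.\<close>

definition F1 ::
  "real \<Rightarrow> real \<Rightarrow> real \<Rightarrow> real \<Rightarrow> real \<Rightarrow> 'a::real_inner \<Rightarrow> 'a \<Rightarrow> real \<Rightarrow> real" where
  "F1 r l1 l2 \<beta>1 \<beta>2 v1 v2 \<delta> =
     - (\<bar>l1 - 2 * \<delta>\<bar>^2 * \<bar>l2 - 2 * \<delta>\<bar>^2 * r^2)
     + \<bar>l1 * \<beta>1\<bar>^2 * \<bar>l2 - 2 * \<delta>\<bar>^2
     + \<bar>l2 * \<beta>2\<bar>^2 * \<bar>l1 - 2 * \<delta>\<bar>^2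
     + l1 * \<beta>1 * l2 * \<beta>2 * (l2 - 2 * \<delta>) * (l1 - 2 * \<delta>) * (v1 \<bullet> v2)
     + l1 * \<beta>1 * l2 * \<beta>2 * (l2 - 2 * \<delta>) * (l1 - 2 * \<delta>) * (v2 \<bullet> v1)"

end

theory Submission
  imports Defs
begin

text \<open>Since $B G^{-1} B^\top = I$, an undesired equilibrium with indicator $\delta$ is a point
  $x = x_c + y$ with $\|y\| = r$ and $\tilde A x = 2\delta y$. Resonance $2\delta = \lambda_i$ would make
  $x_c$ an eigenvector by Cayley--Hamilton; otherwise $y$ is determined by $\delta$, and
  $F_1(\delta) = (\lambda_1 - 2\delta)^2 (\lambda_2 - 2\delta)^2 (\|y\|^2 - r^2)$. Near such a point
  $2 y^\top \dot x = - \alpha(h)$, so the Jacobian is triangular with respect to the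
  normal $y$ and its orthogonal complement, with eigenvalues $-\alpha'(0)$ and
  $\mu = t^\top \tilde A t / \|t\|^2 - 2\delta$ for $t \perp y$. In eigenvector coordinates
  $\mu r^2$ is at least $(\lambda_1 - 2\delta) r^2$ in case (i) and at most $(\lambda_2 - 2\delta) r^2$ in case (ii).
  As $\alpha$ is merely differentiable, stability comes from a quadratic Lyapunov function,
  which needs differentiability of the vector field at the equilibrium only. In case (iii), $F_1$ is
  positive at $\lambda_1/2$ and $0$ and negative far out; by Rolle a second negative root would
  force a second critical point.\<close>

subsection \<open>Linear algebra and gradients\<close>

lemma matrix_vector_mult_2:
  fixes M :: "'a::comm_semiring_1 ^2 ^2"
  shows "(M *v x) $ 1 = M $ 1 $ 1 * x $ 1 + M $ 1 $ 2 * x $ 2"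
    and "(M *v x) $ 2 = M $ 2 $ 1 * x $ 1 + M $ 2 $ 2 * x $ 2"
  by (simp_all add: matrix_vector_mult_def sum_2)

lemma trace_2: "trace (M :: 'a::semiring_1 ^2 ^2) = M $ 1 $ 1 + M $ 2 $ 2"
  by (simp add: trace_def sum_2)

text \<open>Cramer's rule: \<open>det (M - k I)\<close> annihilates both coordinates of an
  eigenvector, and one of them is nonzero.\<close>

lemma eigenvalue_2_char_poly:
  fixes M :: "'a::field ^2 ^2"
  assumes "eigenvalue M k"
  shows "k^2 - trace M * k + det M = 0"
proof -
  obtain v where v: "v \<noteq> 0" "M *v v = k *s v"
    using assms by (auto simp: eigenvalue_def eigenvector_def)
  have e: "(M$1$1 - k) * v$1 + M$1$2 * v$2 = 0" "M$2$1 * v$1 + (M$2$2 - k) * v$2 = 0"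
    using arg_cong[OF v(2), of "\<lambda>u. u $ 1"] arg_cong[OF v(2), of "\<lambda>u. u $ 2"]
    by (simp_all add: matrix_vector_mult_2 algebra_simps)
  define d where "d = (M$1$1 - k) * (M$2$2 - k) - M$1$2 * M$2$1"
  have "d * v$1 = 0" "d * v$2 = 0"
    using e unfolding d_def by algebra+
  moreover have "v$1 \<noteq> 0 \<or> v$2 \<noteq> 0"
    using v(1) by (auto simp: vec_eq_iff forall_2)
  ultimately have "d = 0" by auto
  then show ?thesis
    by (simp add: d_def trace_2 det_2 power2_eq_square algebra_simps)
qed

lemma trace_2_eq_sum_eigenvalues:
  fixes M :: "'a::field ^2 ^2"
  assumes "eigenvalue M k" "eigenvalue M l" "k \<noteq> l"
  shows "trace M = k + l"
proof -
  have "(k - l) * (k + l - trace M) = 0"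
    using eigenvalue_2_char_poly[OF assms(1)] eigenvalue_2_char_poly[OF assms(2)] by algebra
  then show ?thesis using assms(3) by simp
qed

lemma det_2_eq_prod_eigenvalues:
  fixes M :: "'a::field ^2 ^2"
  assumes "eigenvalue M k" "eigenvalue M l" "k \<noteq> l"
  shows "det M = k * l"
  using eigenvalue_2_char_poly[OF assms(1)] trace_2_eq_sum_eigenvalues[OF assms]
  by (simp add: power2_eq_square algebra_simps)

lemma cayley_hamilton_2:
  fixes M :: "'a::field ^2 ^2"
  shows "M *v (M *v x) = trace M *s (M *v x) - det M *s x"
  by (simp add: vec_eq_iff forall_2 matrix_vector_mult_2 trace_2 det_2 algebra_simps)

text \<open>A real eigenvector, embedded in the complex space, is an eigenvector of the complexified
  matrix for the same eigenvalue.\<close>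

lemma hurwitz_real_eigenvalue_neg:
  fixes M :: "real ^'n ^'n"
  assumes "hurwitz M" "eigenvalue M k"
  shows "k < 0"
proof -
  obtain v where v: "v \<noteq> 0" "M *v v = k *s v"
    using assms by (auto simp: eigenvalue_def eigenvector_def)
  let ?w = "(\<chi> i. complex_of_real (v $ i)) :: complex ^'n"
  have "map_matrix complex_of_real M *v ?w = complex_of_real k *s ?w"
    using v(2) by (simp add: vec_eq_iff matrix_vector_mult_def map_matrix_def
        flip: of_real_mult of_real_sum)
  moreover have "?w \<noteq> 0"
    using v(1) by (simp add: vec_eq_iff)
  ultimately show ?thesis
    using assms(1) unfolding hurwitz_def eigenvalue_def eigenvector_def by fastforce
qed

lemma gradient_eqI:
  assumes "GDERIV f x :> D"
  shows "gradient f x = D"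
  unfolding gradient_def
proof (rule the_equality, rule assms)
  fix D' assume "GDERIV f x :> D'"
  then have "(\<lambda>w. w \<bullet> D') = (\<lambda>w. w \<bullet> D)"
    using assms has_derivative_unique unfolding gderiv_def by blast
  then show "D' = D" by (metis inner_commute vector_eq_ldot)
qed

lemma gradient_norm_sq_diff: "gradient (\<lambda>x. (norm (x - c))^2 - k) x = 2 *\<^sub>R (x - c)"
  by (rule gradient_eqI)
    (auto simp: gderiv_def power2_norm_eq_inner inner_commute intro!: derivative_eq_intros)

text \<open>\<open>B ** matrix_inv (transpose B ** B)\<close> is a right inverse of
  \<open>transpose B\<close>, hence, for square matrices, also a left inverse. With this choice of
  \<open>G\<close> the filter pushes along the gradient itself.\<close>

lemma matrix_inv_gram:
  fixes B :: "real ^'n ^'n"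
  assumes "invertible B"
  shows "B ** matrix_inv (transpose B ** B) ** transpose B = mat 1"
proof -
  have inv: "invertible (transpose B ** B)"
    using assms by (simp add: invertible_det_nz det_mul)
  let ?C = "B ** matrix_inv (transpose B ** B)"
  have "(transpose B ** B) ** matrix_inv (transpose B ** B) = mat 1"
    using inv unfolding invertible_def matrix_inv_def by (rule someI2_ex) simp
  then have "transpose B ** ?C = mat 1" by (simp add: matrix_mul_assoc)
  then show ?thesis by (simp add: matrix_left_right_inverse)
qed

subsection \<open>Lyapunov stability\<close>

lemma solves_on_subset: "solves_on f x I \<Longrightarrow> J \<subseteq> I \<Longrightarrow> solves_on f x J"
  unfolding solves_on_def by (meson has_vector_derivative_within_subset subsetD)

text \<open>The decay inequality is available only where \<open>V < k\<close>, so the solution has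
  to be kept there: until a first exit time, \<open>exp (c * t) * V (x t)\<close> cannot increase,
  which rules out an exit.\<close>

lemma lyapunov_decay:
  fixes x :: "real \<Rightarrow> 'a::real_normed_vector"
  assumes sol: "solves_on f x {0..T}" and T: "T \<ge> 0"
    and V: "\<And>x. (V has_derivative V' x) (at x)"
    and dec: "\<And>x. V x < k \<Longrightarrow> V' x (f x) \<le> - c * V x"
    and nn: "\<And>x. V x \<ge> 0" and c: "c > 0" and ini: "V (x 0) < k"
  shows "V (x T) \<le> V (x 0) * exp (- c * T)"
proof -
  define \<phi> where "\<phi> t = exp (c * t) * V (x t)" for t
  have dV: "((\<lambda>t. V (x t)) has_real_derivative V' (x t) (f (x t))) (at t within {0..T})"
    if "t \<in> {0..T}" for t
  proof -
    have "(x has_vector_derivative f (x t)) (at t within {0..T})"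
      using sol that by (simp add: solves_on_def)
    then have "((\<lambda>t. V (x t)) has_vector_derivative V' (x t) (f (x t))) (at t within {0..T})"
      using vector_derivative_diff_chain_within[OF _ has_derivative_at_withinI[OF V]]
      by (simp add: o_def)
    then show ?thesis by (simp add: has_real_derivative_iff_has_vector_derivative)
  qed
  have contV: "continuous_on {0..T} (\<lambda>t. V (x t))"
    using dV by (rule DERIV_continuous_on)
  \<comment> \<open>The bound \<open>V < k\<close> is asked for strictly before \<open>t\<close>
    only, so that this also applies when \<open>t\<close> is the first exit time itself.\<close>
  have mono: "\<phi> t \<le> \<phi> 0" if t: "0 \<le> t" "t \<le> T" and lt: "\<And>s. 0 < s \<Longrightarrow> s < t \<Longrightarrow> V (x s) < k" for t
  proof (cases "t = 0")
    case False
    have "continuous_on {0..t} \<phi>"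
      unfolding \<phi>_def
      by (intro continuous_intros continuous_on_subset[OF contV]) (use t in auto)
    moreover have "\<exists>y. (\<phi> has_real_derivative y) (at s) \<and> y \<le> 0" if s: "0 < s" "s < t" for s
    proof -
      have "((\<lambda>t. V (x t)) has_real_derivative V' (x s) (f (x s))) (at s)"
        using dV[of s] s t at_within_Icc_at[of 0 s T] by auto
      then have "(\<phi> has_real_derivative exp (c * s) * (c * V (x s) + V' (x s) (f (x s)))) (at s)"
        unfolding \<phi>_def by (auto intro!: derivative_eq_intros simp: algebra_simps)
      moreover have "exp (c * s) * (c * V (x s) + V' (x s) (f (x s))) \<le> 0"
        using dec[OF lt[OF s]] by (intro mult_nonneg_nonpos) auto
      ultimately show ?thesis by blast
    qed
    ultimately show ?thesis
      using DERIV_nonpos_imp_decreasing_open[of 0 t \<phi>] t by auto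
  qed auto
  have below: "V (x t) < k" if "t \<in> {0..T}" for t
  proof (rule ccontr)
    define S where "S = {s \<in> {0..T}. k \<le> V (x s)}"
    assume "\<not> V (x t) < k"
    then have ne: "S \<noteq> {}" using that by (auto simp: S_def)
    have "closed S"
      using continuous_closed_preimage[OF contV closed_atLeastAtMost closed_atLeast[of k]]
      by (simp add: S_def vimage_def Int_def)
    moreover have bb: "bdd_below S" unfolding S_def by (rule bdd_belowI[of _ 0]) auto
    ultimately have t1: "Inf S \<in> S" using ne by (intro closed_contains_Inf)
    have "\<phi> (Inf S) \<le> \<phi> 0"
    proof (rule mono)
      show "V (x s) < k" if "0 < s" "s < Inf S" for s
        using that cInf_lower[OF _ bb, of s] t1 by (force simp: S_def)
    qed (use t1 in \<open>auto simp: S_def\<close>)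
    moreover have "V (x (Inf S)) \<le> \<phi> (Inf S)"
      using t1 c nn[of "x (Inf S)"] unfolding \<phi>_def
      by (simp add: S_def mult_le_cancel_right1)
    ultimately show False using t1 ini by (simp add: S_def \<phi>_def)
  qed
  have "\<phi> T \<le> \<phi> 0" by (rule mono) (use T below in auto)
  then show ?thesis by (simp add: \<phi>_def exp_minus field_simps)
qed

text \<open>By coercivity the sublevel set of level \<open>m * d^2\<close> lies in the ball of
  radius \<open>d\<close>. For small \<open>d\<close> the decay estimate therefore holds on a whole
  sublevel set, and \<open>V\<close> decays exponentially along trajectories that start
  there.\<close>

lemma asymptotically_stable_lyapunov:
  fixes f :: "'a::real_normed_vector \<Rightarrow> 'a"
  assumes eq: "equilibrium f p"
    and V: "\<And>x. (V has_derivative V' x) (at x)" and V0: "V p = 0"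
    and coer: "\<And>x. m * (dist x p)^2 \<le> V x" and m: "m > 0"
    and dec: "\<And>x. dist x p < e \<Longrightarrow> V' x (f x) \<le> - c * V x"
    and c: "c > 0" and e: "e > 0"
  shows "asymptotically_stable f p"
proof -
  have nn: "V x \<ge> 0" for x
    using coer[of x] m by (meson mult_nonneg_nonneg order_trans less_imp_le zero_le_power2)
  have near: "dist x p < d" if "V x < m * d^2" "d > 0" for x d
  proof -
    have "m * (dist x p)^2 < m * d^2" using coer[of x] that by linarith
    then have "(dist x p)^2 < d^2" using m by simp
    then show ?thesis using that(2) by (simp add: power2_less_imp_less)
  qed
  have dec': "V' x (f x) \<le> - c * V x" if "V x < m * d^2" "0 < d" "d \<le> e" for x d
    using near[of x d] that dec[of x] by auto
  have small: "\<exists>\<rho>>0. \<forall>x. dist x p < \<rho> \<longrightarrow> V x < m * d^2" if "d > 0" for d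
  proof -
    have "isCont V p" using V has_derivative_continuous by blast
    moreover have "m * d^2 > 0" using m that by simp
    ultimately show ?thesis
      unfolding continuous_at_eps_delta using V0 nn
      by (metis abs_of_nonneg diff_zero dist_real_def)
  qed
  have "lyapunov_stable f p"
    unfolding lyapunov_stable_def
  proof (intro allI impI)
    fix \<epsilon> :: real assume "\<epsilon> > 0"
    \<comment> \<open>The sublevel set of level \<open>m * d^2\<close> must lie both in the target
      ball and in the region of decay.\<close>
    define d where "d = min \<epsilon> e"
    have d: "d > 0" "d \<le> e" "d \<le> \<epsilon>" using \<open>\<epsilon> > 0\<close> e by (auto simp: d_def)
    obtain \<rho> where \<rho>: "\<rho> > 0" "\<And>x. dist x p < \<rho> \<Longrightarrow> V x < m * d^2"
      using small[OF d(1)] by blast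
    have "dist (x t) p < \<epsilon>"
      if sol: "solves_on f x {0..T}" and ini: "dist (x 0) p < \<rho>" and t: "t \<in> {0..T}" for x T t
    proof -
      have "solves_on f x {0..t}"
        by (rule solves_on_subset[OF sol]) (use t in auto)
      then have "V (x t) \<le> V (x 0) * exp (- c * t)"
        by (rule lyapunov_decay[where V' = V' and k = "m * d^2"]) (use t V dec' nn c \<rho>(2) ini d in auto)
      also have "\<dots> \<le> V (x 0)"
        using nn c t by (simp add: mult_left_le)
      also have "\<dots> < m * d^2" by (rule \<rho>(2)[OF ini])
      finally show ?thesis using near d by fastforce
    qed
    then show "\<exists>\<rho>>0. \<forall>x. \<forall>T>0. solves_on f x {0..T} \<and> dist (x 0) p < \<rho> \<longrightarrow>
        (\<forall>t\<in>{0..T}. dist (x t) p < \<epsilon>)"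
      using \<rho>(1) by blast
  qed
  moreover have "locally_attractive f p"
    unfolding locally_attractive_def
  proof -
    obtain \<rho> where \<rho>: "\<rho> > 0" "\<And>x. dist x p < \<rho> \<Longrightarrow> V x < m * e^2"
      using small[OF e] by blast
    have "(x \<longlongrightarrow> p) at_top" if sol: "solves_on f x {0..}" and ini: "dist (x 0) p < \<rho>" for x
    proof (rule tendstoI)
      fix d :: real assume d: "d > 0"
      have "((\<lambda>t. V (x 0) * exp (- c * t)) \<longlongrightarrow> 0) at_top"
      proof (intro tendsto_mult_right_zero filterlim_compose[OF exp_at_bot])
        show "filterlim (\<lambda>t. - c * t) at_bot at_top"
          using c by (intro filterlim_tendsto_neg_mult_at_bot[OF tendsto_const _ filterlim_ident]) auto
      qed
      moreover have "m * d^2 > 0" using m d by simp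
      ultimately have "\<forall>\<^sub>F t in at_top. V (x 0) * exp (- c * t) < m * d^2"
        by (rule order_tendstoD)
      then show "\<forall>\<^sub>F t in at_top. dist (x t) p < d"
        using eventually_ge_at_top[of 0]
      proof eventually_elim
        case (elim t)
        have "solves_on f x {0..t}"
          by (rule solves_on_subset[OF sol]) auto
        then have "V (x t) \<le> V (x 0) * exp (- c * t)"
          by (rule lyapunov_decay[where V' = V' and k = "m * e^2"]) (use elim V dec' nn c \<rho>(2) ini e in auto)
        then show ?case using near[OF _ d] elim by simp
      qed
    qed
    then show "\<exists>\<rho>>0. \<forall>x. solves_on f x {0..} \<and> dist (x 0) p < \<rho> \<longrightarrow> (x \<longlongrightarrow> p) at_top"
      using \<rho>(1) by blast
  qed
  ultimately show ?thesis using eq by (simp add: asymptotically_stable_def)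
qed

text \<open>The quadratic form \<open>P z \<bullet> z\<close> is a Lyapunov function: its derivative
  along the linear part is at most \<open>- 2 * c * (norm z)^2\<close>, and the remainder of the
  expansion at \<open>p\<close> is too small near \<open>p\<close> to spoil this.\<close>

lemma asymptotically_stable_linearization:
  fixes f :: "'a::real_inner \<Rightarrow> 'a"
  assumes eq: "equilibrium f p" and J: "(f has_derivative J) (at p)"
    and P: "bounded_linear P" and sym: "\<And>z w. P z \<bullet> w = z \<bullet> P w"
    and pos: "\<And>z. m * (norm z)^2 \<le> P z \<bullet> z" and m: "m > 0"
    and neg: "\<And>z. P z \<bullet> J z \<le> - c * (norm z)^2" and c: "c > 0"
  shows "asymptotically_stable f p"
proof -
  obtain K where K: "K > 0" "\<And>z. norm (P z) \<le> norm z * K"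
    using bounded_linear.pos_bounded[OF P] by blast
  \<comment> \<open>With this value the remainder uses up at most half of the decay supplied by
    \<open>J\<close>.\<close>
  define \<epsilon> where "\<epsilon> = c / (2 * K)"
  have \<epsilon>: "\<epsilon> > 0" "\<epsilon> * K = c / 2" using c K by (auto simp: \<epsilon>_def)
  obtain e where e: "e > 0"
    and rem: "\<And>x. norm (x - p) < e \<Longrightarrow> norm (f x - f p - J (x - p)) \<le> \<epsilon> * norm (x - p)"
    using J \<epsilon>(1) unfolding has_derivative_at_alt by blast
  define V where "V x = P (x - p) \<bullet> (x - p)" for x
  define V' where "V' x w = 2 * (P (x - p) \<bullet> w)" for x w
  have PK: "P z \<bullet> z \<le> K * (norm z)^2" for z
  proof -
    have "P z \<bullet> z \<le> norm (P z) * norm z" by (rule norm_cauchy_schwarz)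
    also have "\<dots> \<le> (norm z * K) * norm z" by (intro mult_right_mono K) auto
    finally show ?thesis by (simp add: power2_eq_square mult_ac)
  qed
  show ?thesis
  proof (rule asymptotically_stable_lyapunov[OF eq])
    show "(V has_derivative V' x) (at x)" for x
    proof -
      have "((\<lambda>x. P (x - p)) has_derivative P) (at x)"
        by (intro bounded_linear.has_derivative[OF P]) (auto intro!: derivative_eq_intros)
      then have "(V has_derivative (\<lambda>w. P (x - p) \<bullet> w + P w \<bullet> (x - p))) (at x)"
        unfolding V_def by (auto intro!: derivative_eq_intros)
      moreover have "P w \<bullet> (x - p) = P (x - p) \<bullet> w" for w
        by (metis sym inner_commute)
      ultimately show ?thesis by (simp add: V'_def[abs_def])
    qed
    show "V p = 0" by (simp add: V_def)
    show "m * (dist x p)^2 \<le> V x" for x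
      using pos[of "x - p"] by (simp add: V_def dist_norm)
    show "V' x (f x) \<le> - (c / K) * V x" if "dist x p < e" for x
    proof -
      let ?z = "x - p"
      let ?R = "f x - J ?z"
      have R: "norm ?R \<le> \<epsilon> * norm ?z"
        using rem[of x] that eq by (simp add: dist_norm equilibrium_def)
      have "P ?z \<bullet> ?R \<le> norm (P ?z) * norm ?R" by (rule norm_cauchy_schwarz)
      also have "\<dots> \<le> (norm ?z * K) * (\<epsilon> * norm ?z)"
        using K R by (intro mult_mono) auto
      also have "\<dots> = (\<epsilon> * K) * (norm ?z)^2" by (simp add: power2_eq_square mult_ac)
      finally have "P ?z \<bullet> ?R \<le> c / 2 * (norm ?z)^2" using \<epsilon> by simp
      moreover have "P ?z \<bullet> f x = P ?z \<bullet> J ?z + P ?z \<bullet> ?R"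
        by (simp add: inner_diff_right)
      ultimately have "V' x (f x) \<le> - c * (norm ?z)^2"
        using neg[of ?z] by (simp add: V'_def)
      moreover have "c / K * V x \<le> c / K * (K * (norm ?z)^2)"
        using PK[of ?z] c K by (intro mult_left_mono) (auto simp: V_def)
      ultimately show ?thesis using K by simp
    qed
  qed (use m e c K in auto)
qed

subsection \<open>Planar linearizations with an invariant direction\<close>

text \<open>Rotation by a right angle; for nonzero \<open>y\<close> it completes \<open>y\<close> to
  an orthogonal basis of vectors of equal length.\<close>

definition perp :: "real ^2 \<Rightarrow> real ^2" where
  "perp y = vector [- (y $ 2), y $ 1]"

lemma inner_2: "(x :: real ^2) \<bullet> y = x $ 1 * y $ 1 + x $ 2 * y $ 2"
  by (simp add: inner_vec_def sum_2)

lemma perp_orthogonal [simp]: "perp y \<bullet> y = 0" "y \<bullet> perp y = 0"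
  by (simp_all add: perp_def inner_2)

lemma perp_inner_perp [simp]: "perp y \<bullet> perp y = y \<bullet> y"
  by (simp add: perp_def inner_2)

lemma perp_eq_0_iff [simp]: "perp y = 0 \<longleftrightarrow> y = 0"
  using perp_inner_perp[of y] by (metis inner_eq_zero_iff)

lemma perp_decomposition: "(y \<bullet> y) *\<^sub>R z = (perp y \<bullet> z) *\<^sub>R perp y + (y \<bullet> z) *\<^sub>R y"
  by (simp add: vec_eq_iff forall_2 perp_def inner_2 algebra_simps)

lemma perp_parseval: "(perp y \<bullet> z)^2 + (y \<bullet> z)^2 = (y \<bullet> y) * (norm z)^2"
  unfolding power2_norm_eq_inner by (simp add: perp_def inner_2 algebra_simps power2_eq_square)

text \<open>The trace is the sum of the diagonal entries in the orthogonal basis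
  \<open>perp y\<close>, \<open>y\<close>. The tangential entry can thus be found from the normal
  one.\<close>

lemma trace_perp: "perp y \<bullet> (M *v perp y) + y \<bullet> (M *v y) = trace M * (y \<bullet> y)"
  by (simp add: perp_def inner_2 matrix_vector_mult_2 trace_2 algebra_simps)

text \<open>In the basis \<open>perp y\<close>, \<open>y\<close> the Jacobian is triangular with
  diagonal \<open>\<mu>\<close>, \<open>- a\<close>; the remaining entry, the tangential part of
  \<open>J y\<close>, is left free.\<close>

locale planar_linearization =
  fixes f :: "real ^2 \<Rightarrow> real ^2" and p :: "real ^2" and J :: "real ^2 \<Rightarrow> real ^2"
    and y :: "real ^2" and a \<mu> :: real
  assumes eq: "equilibrium f p" and J: "(f has_derivative J) (at p)"
    and y_nz: "y \<noteq> 0" and a_pos: "a > 0"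
    and normal: "\<And>w. y \<bullet> J w = - a * (y \<bullet> w)"
    and tangential: "perp y \<bullet> J (perp y) = \<mu> * (y \<bullet> y)"
begin

lemma yy_pos: "y \<bullet> y > 0" using y_nz by simp

lemma J_perp: "J (perp y) = \<mu> *\<^sub>R perp y"
proof -
  have "(y \<bullet> y) *\<^sub>R J (perp y) = (y \<bullet> y) *\<^sub>R (\<mu> *\<^sub>R perp y)"
    unfolding perp_decomposition[of y "J (perp y)"] tangential normal by simp
  then show ?thesis using y_nz by (simp del: scaleR_scaleR)
qed

lemma jacobian_eq: "jacobian f (at p) *v w = J w"
  using J frechet_derivative_at[OF J] has_derivative_linear[OF J] by (simp add: jacobian_def)

lemma saddle_pointI:
  assumes "\<mu> > 0"
  shows "saddle_point f p"
proof -
  have "eigenvalue (jacobian f (at p)) \<mu>"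
    unfolding eigenvalue_def eigenvector_def
    by (rule exI[of _ "perp y"]) (simp add: jacobian_eq J_perp y_nz scalar_mult_eq_scaleR)
  moreover have "eigenvalue (jacobian f (at p)) (- a)"
  proof -
    define c where "c = (perp y \<bullet> J y) / (y \<bullet> y)"
    \<comment> \<open>Chosen so that the tangential component of
      \<open>J (y + s *\<^sub>R perp y)\<close> is \<open>- a * s\<close>; the denominator is
      positive.\<close>
    define s where "s = - c / (a + \<mu>)"
    have s: "c + s * \<mu> = - a * s" using assms a_pos by (simp add: s_def field_simps)
    have "(y \<bullet> y) *\<^sub>R J y = (y \<bullet> y) *\<^sub>R (c *\<^sub>R perp y - a *\<^sub>R y)"
      unfolding perp_decomposition[of y "J y"] normal
      using y_nz by (simp add: c_def scaleR_right_diff_distrib mult.commute)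
    then have Jy: "J y = c *\<^sub>R perp y - a *\<^sub>R y" using y_nz by simp
    have "J (y + s *\<^sub>R perp y) = (c + s * \<mu>) *\<^sub>R perp y - a *\<^sub>R y"
      using has_derivative_linear[OF J]
      by (simp add: linear_add linear_scale Jy J_perp scaleR_left_distrib)
    also have "\<dots> = (- a) *\<^sub>R (y + s *\<^sub>R perp y)"
      unfolding s by (simp add: scaleR_right_distrib)
    finally have "J (y + s *\<^sub>R perp y) = (- a) *\<^sub>R (y + s *\<^sub>R perp y)" .
    moreover have "y \<bullet> (y + s *\<^sub>R perp y) \<noteq> 0"
      using y_nz by (simp add: inner_add_right)
    ultimately show ?thesis
      unfolding eigenvalue_def eigenvector_def
      by (intro exI[of _ "y + s *\<^sub>R perp y"]) (auto simp: jacobian_eq scalar_mult_eq_scaleR)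
  qed
  ultimately show ?thesis
    using eq J a_pos assms unfolding saddle_point_def differentiable_def
    by (meson neg_less_0_iff_less)
qed

text \<open>Both diagonal entries are negative, so the form
  \<open>(perp y \<bullet> z)^2 + M * (y \<bullet> z)^2\<close> decreases once the normal direction
  is weighted heavily enough.\<close>

lemma asymptotically_stableI:
  assumes "\<mu> < 0"
  shows "asymptotically_stable f p"
proof -
  define \<kappa> where "\<kappa> = (perp y \<bullet> J y) / (y \<bullet> y)"
  \<comment> \<open>\<open>M\<close> is large enough for completing the square to absorb the coupling term \<open>\<kappa>\<close>.\<close>
  define M where "M = 1 + \<kappa>^2 / (2 * (- \<mu>) * a)"
  define c where "c = min (- \<mu> / 2) a"
  define P where "P z = (perp y \<bullet> z) *\<^sub>R perp y + (M * (y \<bullet> z)) *\<^sub>R y" for z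
  have M: "M \<ge> 1" using assms a_pos by (simp add: M_def divide_nonneg_neg mult_neg_pos)
  have c: "c > 0" "c \<le> - \<mu> / 2" "c \<le> a" using assms a_pos by (auto simp: c_def)
  show ?thesis
  proof (rule asymptotically_stable_linearization[OF eq J])
    show "bounded_linear P" unfolding P_def by (intro bounded_linear_intros)
    show "P z \<bullet> w = z \<bullet> P w" for z w
      by (simp add: P_def inner_add_left inner_add_right inner_commute)
    show "(y \<bullet> y) * (norm z)^2 \<le> P z \<bullet> z" for z
    proof -
      have "(perp y \<bullet> z)^2 + 1 * (y \<bullet> z)^2 \<le> (perp y \<bullet> z)^2 + M * (y \<bullet> z)^2"
        by (intro add_left_mono mult_right_mono M) simp
      then show ?thesis
        unfolding perp_parseval[symmetric]
        by (simp add: P_def inner_add_left power2_eq_square mult.assoc)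
    qed
    show "P z \<bullet> J z \<le> - (c * (y \<bullet> y)) * (norm z)^2" for z
    proof -
      define \<tau> \<sigma> where "\<tau> = perp y \<bullet> z" and "\<sigma> = y \<bullet> z"
      have "(y \<bullet> y) *\<^sub>R J z = J (\<tau> *\<^sub>R perp y + \<sigma> *\<^sub>R y)"
        unfolding \<tau>_def \<sigma>_def perp_decomposition[symmetric]
        using has_derivative_linear[OF J] by (simp add: linear_scale)
      also have "\<dots> = (\<tau> * \<mu>) *\<^sub>R perp y + \<sigma> *\<^sub>R J y"
        using has_derivative_linear[OF J] by (simp add: linear_add linear_scale J_perp)
      finally have "perp y \<bullet> ((y \<bullet> y) *\<^sub>R J z) = perp y \<bullet> ((\<tau> * \<mu>) *\<^sub>R perp y + \<sigma> *\<^sub>R J y)"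
        by simp
      then have "perp y \<bullet> J z = \<mu> * \<tau> + \<kappa> * \<sigma>"
        using yy_pos by (simp add: \<kappa>_def inner_add_right field_simps)
      then have "P z \<bullet> J z = \<mu> * \<tau>^2 + \<kappa> * \<sigma> * \<tau> - M * a * \<sigma>^2"
        unfolding P_def
        by (simp add: inner_add_left normal \<tau>_def[symmetric] \<sigma>_def[symmetric]
            power2_eq_square algebra_simps)
      \<comment> \<open>Half of the tangential decay is kept; the other half, the cross term and the
        excess of \<open>M\<close> over 1 form a complete square divided by a negative
        number.\<close>
      also have "\<dots> = \<mu> / 2 * \<tau>^2 - a * \<sigma>^2 + (\<mu> * \<tau> + \<kappa> * \<sigma>)^2 / (2 * \<mu>)"
        using assms a_pos by (simp add: M_def power2_eq_square field_simps)
      also have "\<dots> \<le> \<mu> / 2 * \<tau>^2 - a * \<sigma>^2"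
        using assms by (simp add: divide_nonneg_neg)
      also have "\<dots> \<le> - c * \<tau>^2 - c * \<sigma>^2"
        using c mult_right_mono[of c "- \<mu> / 2" "\<tau>^2"] mult_right_mono[of c a "\<sigma>^2"] by simp
      also have "\<dots> = - c * (\<tau>^2 + \<sigma>^2)" by (simp add: algebra_simps)
      also have "\<dots> = - (c * (y \<bullet> y)) * (norm z)^2"
        unfolding \<tau>_def \<sigma>_def perp_parseval by simp
      finally show ?thesis .
    qed
  qed (use yy_pos c in auto)
qed

end

subsection \<open>The filtered system near an undesired equilibrium\<close>

lemma ball_filter_margin:
  "filter_margin At (\<lambda>x. (norm (x - c))^2 - r^2) \<alpha> x =
    2 * ((x - c) \<bullet> (At *v x)) + \<alpha> ((norm (x - c))^2 - r^2)"
  by (simp add: filter_margin_def gradient_norm_sq_diff)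

text \<open>Once \<open>B\<close> cancels, the active filter subtracts a multiple of the gradient
  \<open>2 *\<^sub>R (x - c)\<close>, normalized by its squared length; hence the single 2 in the
  denominator.\<close>

lemma ball_filtered_system:
  fixes B :: "real ^'n ^'n"
  assumes "invertible B"
    and neg: "filter_margin At (\<lambda>x. (norm (x - c))^2 - r^2) \<alpha> x < 0"
  shows "filtered_system At B (\<lambda>x. transpose B ** B) (\<lambda>x. (norm (x - c))^2 - r^2) \<alpha> x =
    At *v x - (filter_margin At (\<lambda>x. (norm (x - c))^2 - r^2) \<alpha> x /
      (2 * ((x - c) \<bullet> (x - c)))) *\<^sub>R (x - c)"
proof -
  let ?C = "matrix_inv (transpose B ** B) ** transpose B"
  have BC: "B *v (?C *v w) = w" for w
    by (simp add: matrix_vector_mul_assoc matrix_mul_assoc matrix_inv_gram[OF assms(1)])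
  show ?thesis
    using neg
    by (simp add: filtered_system_def safety_filter_def gradient_norm_sq_diff matrix_inv_gram[OF assms(1)]
        vec.neg vec.scale BC matrix_vector_mult_scaleR divide_simps)
qed

lemma ball_undesired_equilibrium_iff:
  fixes B :: "real ^'n ^'n"
  assumes "invertible B" "r > 0"
  shows "undesired_equilibrium_with_indicator At B (\<lambda>x. transpose B ** B)
      (\<lambda>x. (norm (x - c))^2 - r^2) p \<delta> \<longleftrightarrow>
    norm (p - c) = r \<and> \<delta> < 0 \<and> At *v p = (2 * \<delta>) *\<^sub>R (p - c)"
  using assms(2)
  by (auto simp: undesired_equilibrium_with_indicator_def gradient_norm_sq_diff
      matrix_inv_gram[OF assms(1)] mult.commute)

text \<open>At \<open>p\<close> the margin is \<open>4 * \<delta> * r^2 < 0\<close>, so the filter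
  is active on a neighbourhood and the field coincides there with the explicit field
  \<open>g\<close>, which is differentiable at \<open>p\<close>.\<close>

lemma ball_filter_linearization:
  fixes At B :: "real ^2 ^2"
  defines "f \<equiv> \<lambda>c r \<alpha>. filtered_system At B (\<lambda>x. transpose B ** B) (\<lambda>x. (norm (x - c))^2 - r^2) \<alpha>"
  assumes B: "invertible B" and r: "r > 0"
    and \<alpha>0: "\<alpha> 0 = 0" and \<alpha>_diff: "\<And>s. \<alpha> differentiable (at s)" and \<alpha>': "deriv \<alpha> 0 > 0"
    and p: "norm (p - c) = r" "\<delta> < 0" "At *v p = (2 * \<delta>) *\<^sub>R (p - c)"
  obtains J where "planar_linearization (f c r \<alpha>) p J (p - c) (deriv \<alpha> 0)
    ((perp (p - c) \<bullet> (At *v perp (p - c))) / r^2 - 2 * \<delta>)"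
proof -
  define y where "y = p - c"
  define \<eta> where "\<eta> x = 2 * ((x - c) \<bullet> (At *v x)) + \<alpha> ((norm (x - c))^2 - r^2)" for x
  define q where "q x = \<eta> x / (2 * ((x - c) \<bullet> (x - c)))" for x
  define g where "g x = At *v x - q x *\<^sub>R (x - c)" for x
  have yy: "y \<bullet> y = r^2" "y \<noteq> 0" using p(1) r by (auto simp: y_def dot_square_norm)
  have f_eq: "f c r \<alpha> x = g x" if "\<eta> x < 0" for x
    using ball_filtered_system[OF B, of At c r \<alpha> x] that
    by (simp add: f_def g_def q_def \<eta>_def ball_filter_margin)
  have \<eta>_p: "\<eta> p = 4 * \<delta> * r^2"
    using yy p \<alpha>0 by (simp add: \<eta>_def y_def)
  have q_p: "q p = 2 * \<delta>"
    using yy r unfolding q_def \<eta>_p by (simp add: y_def)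
  have \<eta>_neg: "\<eta> p < 0" using \<eta>_p p(2) r by (simp add: mult_neg_pos)
  have \<alpha>_der: "(\<alpha> has_real_derivative deriv \<alpha> s) (at s)" for s
    using \<alpha>_diff by (simp add: DERIV_deriv_iff_real_differentiable)
  have \<alpha>h_der: "((\<lambda>x. \<alpha> ((norm (x - c))^2 - r^2)) has_derivative
      (\<lambda>w. 2 * (y \<bullet> w) * deriv \<alpha> 0)) (at p)"
  proof -
    have "((\<lambda>x. (norm (x - c))^2 - r^2) has_derivative (\<lambda>w. 2 * (y \<bullet> w))) (at p)"
      unfolding power2_norm_eq_inner
      by (auto simp: y_def inner_commute intro!: derivative_eq_intros)
    moreover have "(\<alpha> has_real_derivative deriv \<alpha> 0) (at ((norm (p - c))^2 - r^2))"
      using \<alpha>_der[of 0] p(1) by simp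
    ultimately show ?thesis
      by (rule DERIV_compose_FDERIV[rotated])
  qed
  have At_der: "((\<lambda>x. At *v x) has_derivative (\<lambda>w. At *v w)) (at x)" for x
    by (intro bounded_linear_imp_has_derivative) (simp add: matrix_vector_mul_bounded_linear)
  have \<eta>_diff: "\<eta> differentiable (at p)"
    unfolding \<eta>_def using At_der \<alpha>h_der
    by (intro differentiable_add differentiable_mult differentiable_inner differentiable_diff)
      (auto intro: differentiableI)
  have q_diff: "q differentiable (at p)"
    unfolding q_def using \<eta>_diff yy
    by (intro differentiable_divide differentiable_mult differentiable_inner differentiable_diff)
      (auto simp: y_def)
  then obtain Dq where Dq: "(q has_derivative Dq) (at p)" by (auto simp: differentiable_def)
  \<comment> \<open>\<open>Dq\<close> can stay unknown: its term points along \<open>y\<close>,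
    which is orthogonal to the tangent, and the normal row is obtained separately.\<close>
  define J where "J w = At *v w - ((2 * \<delta>) *\<^sub>R w + Dq w *\<^sub>R y)" for w
  have g_der: "(g has_derivative J) (at p)"
    unfolding g_def J_def
    by (auto intro!: derivative_eq_intros At_der Dq simp: q_p y_def)
  have near: "\<forall>\<^sub>F x in nhds p. \<eta> x < 0"
  proof (rule order_tendstoD(2)[OF _ \<eta>_neg])
    show "(\<eta> \<longlongrightarrow> \<eta> p) (nhds p)"
      using differentiable_imp_continuous_within[OF \<eta>_diff]
      by (simp only: isCont_def tendsto_at_iff_tendsto_nhds)
  qed
  have f_der: "(f c r \<alpha> has_derivative J) (at p)"
    using g_der
    by (rule has_derivative_transform_eventually)
      (use near \<eta>_neg in \<open>auto simp: eventually_nhds_conv_at f_eq elim: eventually_mono\<close>)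
  have g_p: "g p = 0" by (simp add: g_def q_p p(3))
  show thesis
  proof (rule that[of J], unfold_locales, goal_cases)
    case 1
    then show ?case using g_p f_eq[OF \<eta>_neg] by (simp add: equilibrium_def)
  next
    case 2
    then show ?case by (rule f_der)
  next
    case 3
    then show ?case using yy by (simp add: y_def)
  next
    case 4
    then show ?case by (rule \<alpha>')
  next
    case (5 w)
    \<comment> \<open>Near \<open>p\<close> the filter enforces \<open>(x - c) \<bullet> g x = - \<alpha> (h x) / 2\<close> exactly, so the normal row
      of the Jacobian can be read off without computing \<open>Dq\<close>.\<close>
    have "((\<lambda>x. (x - c) \<bullet> g x) has_derivative (\<lambda>w. y \<bullet> J w)) (at p)"
      by (auto intro!: derivative_eq_intros g_der simp: g_p y_def)
    moreover have "((\<lambda>x. (x - c) \<bullet> g x) has_derivative (\<lambda>w. - (deriv \<alpha> 0 * (y \<bullet> w)))) (at p)"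
    proof (rule has_derivative_transform_eventually)
      show "((\<lambda>x. - (\<alpha> ((norm (x - c))^2 - r^2) / 2)) has_derivative
          (\<lambda>w. - (deriv \<alpha> 0 * (y \<bullet> w)))) (at p)"
        by (auto intro!: derivative_eq_intros \<alpha>h_der)
      \<comment> \<open>The quotient \<open>q\<close> cancels only away from the centre, which is
        enough because \<open>p\<close> is at distance \<open>r > 0\<close> from it.\<close>
      have "(x - c) \<bullet> g x = - (\<alpha> ((norm (x - c))^2 - r^2) / 2)" if "x \<noteq> c" for x
      proof -
        define z where "z = x - c"
        have "z \<bullet> z \<noteq> 0" using that by (simp add: z_def)
        then show ?thesis
          unfolding g_def q_def \<eta>_def z_def[symmetric]
          by (simp add: inner_diff_right field_simps)
      qed
      moreover have "\<forall>\<^sub>F x in nhds p. x \<noteq> c"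
        using yy by (intro t1_space_nhds) (auto simp: y_def)
      ultimately show "\<forall>\<^sub>F x in at p. - (\<alpha> ((norm (x - c))^2 - r^2) / 2) = (x - c) \<bullet> g x"
        "- (\<alpha> ((norm (p - c))^2 - r^2) / 2) = (p - c) \<bullet> g p"
        by (auto simp: eventually_nhds_conv_at g_p p(1) \<alpha>0 elim: eventually_mono)
    qed auto
    ultimately have "(\<lambda>w. y \<bullet> J w) = (\<lambda>w. - (deriv \<alpha> 0 * (y \<bullet> w)))"
      by (rule has_derivative_unique)
    then show ?case by (simp add: y_def fun_eq_iff)
  next
    case 6
    then show ?case
      using yy r unfolding y_def[symmetric]
      by (simp add: J_def inner_diff_right inner_add_right left_diff_distrib)
  qed
qed

subsection \<open>Undesired equilibria in eigenvector coordinates\<close>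

text \<open>The equation says \<open>(M - k) x = - k c\<close>. Applying \<open>M - l\<close> gives
  zero on the left by Cayley-Hamilton, hence \<open>(M - l) c = 0\<close>.\<close>

lemma eigenvector_of_resonant_shift:
  fixes M :: "real ^2 ^2"
  assumes ev: "eigenvalue M k" "eigenvalue M l" "k \<noteq> l" and nz: "k \<noteq> 0" "c \<noteq> 0"
    and shift: "M *v x = k *\<^sub>R (x - c)"
  shows "eigenvector M c l"
proof -
  have "M *v (M *v x) = (k + l) *\<^sub>R (M *v x) - (k * l) *\<^sub>R x"
    using cayley_hamilton_2[of M x]
    by (simp add: trace_2_eq_sum_eigenvalues[OF ev] det_2_eq_prod_eigenvalues[OF ev]
        scalar_mult_eq_scaleR)
  moreover have "M *v (M *v x) = k *\<^sub>R (M *v x - M *v c)"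
    unfolding shift by (simp add: matrix_vector_mult_scaleR matrix_vector_mult_diff_distrib shift)
  ultimately have "k *\<^sub>R (M *v c) = (k * l) *\<^sub>R x - l *\<^sub>R (M *v x)"
    by (simp add: algebra_simps)
  also have "\<dots> = k *\<^sub>R (l *\<^sub>R c)"
    unfolding shift by (simp add: algebra_simps)
  finally have "M *v c = l *\<^sub>R c" using nz by (simp del: scaleR_scaleR)
  then show ?thesis using nz by (simp add: eigenvector_def scalar_mult_eq_scaleR)
qed

text \<open>Transfers the sign condition on the coordinates of the centre to those of an
  equilibrium, which are the former multiplied by factors \<open>a\<close>,
  \<open>b\<close>.\<close>

lemma weighted_projection_nonneg:
  fixes a b x y w :: real
  assumes "x^2 + x * y * w \<ge> 0" "a * b \<ge> 0" "a * (a - b) \<ge> 0"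
  shows "(a * x) * (a * x + b * y * w) \<ge> 0"
proof -
  have "(a * x) * (a * x + b * y * w) = (a * b) * (x^2 + x * y * w) + (a * (a - b)) * x^2"
    by (simp add: power2_eq_square algebra_simps)
  then show ?thesis using assms by simp
qed

section \<open>Growth and critical points of the quartic \<open>F1\<close>\<close>

text \<open>The leading coefficient of \<open>F1\<close> is \<open>- 16 * r^2\<close>, the value at
  0 of the reversed polynomial, whose sign persists near 0 by continuity.\<close>

lemma F1_at_infinity_neg:
  assumes "r > 0"
  obtains R where "R > 0" "\<And>d. \<bar>d\<bar> > R \<Longrightarrow> F1 r l1 l2 b1 b2 v1 v2 d < 0"
proof -
  \<comment> \<open>the reversed polynomial of \<open>F1\<close>\<close>
  define q where "q s = - ((l1 * s - 2)^2 * (l2 * s - 2)^2 * r^2) +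
     s^2 * ((l1 * b1)^2 * (l2 * s - 2)^2 + (l2 * b2)^2 * (l1 * s - 2)^2 +
       2 * (l1 * b1 * l2 * b2 * (l2 * s - 2) * (l1 * s - 2) * (v1 \<bullet> v2)))" for s
  have F1_q: "F1 r l1 l2 b1 b2 v1 v2 d = d^4 * q (1 / d)" if "d \<noteq> 0" for d
  proof -
    have e: "l1 - 2 * d = d * (l1 * (1 / d) - 2)" "l2 - 2 * d = d * (l2 * (1 / d) - 2)"
      using that by (simp_all add: field_simps)
    define A B where "A = l1 * (1 / d) - 2" and "B = l2 * (1 / d) - 2"
    have "d^4 * q (1 / d) = - (d^4 * (A^2 * B^2 * r^2)) + d^4 * (1 / d)^2 *
        ((l1 * b1)^2 * B^2 + (l2 * b2)^2 * A^2 + 2 * (l1 * b1 * l2 * b2 * B * A * (v1 \<bullet> v2)))"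
      unfolding q_def A_def B_def by (simp add: algebra_simps)
    also have "d^4 * (1 / d)^2 = d^2"
      using that by (simp add: field_simps power2_eq_square power4_eq_xxxx)
    finally show ?thesis
      unfolding F1_def power2_abs e A_def[symmetric] B_def[symmetric]
      by (simp add: inner_commute[of v2 v1] power2_eq_square power4_eq_xxxx algebra_simps)
  qed
  have "isCont q 0" unfolding q_def by (intro continuous_intros)
  moreover have "q 0 < 0" using assms by (simp add: q_def)
  ultimately have "\<forall>\<^sub>F s in at 0. q s < 0"
    unfolding isCont_def by (intro order_tendstoD)
  then obtain e where e: "e > 0" "\<And>s. s \<noteq> 0 \<Longrightarrow> \<bar>s\<bar> < e \<Longrightarrow> q s < 0"
    unfolding eventually_at by (auto simp: dist_real_def)
  show thesis
  proof (rule that[of "1 / e"])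
    fix d :: real assume d: "\<bar>d\<bar> > 1 / e"
    then have "d \<noteq> 0" using e(1) by (metis abs_zero less_asym zero_less_divide_1_iff)
    moreover have "\<bar>1 / d\<bar> < e" using d e(1) \<open>d \<noteq> 0\<close> by (simp add: abs_divide field_simps)
    ultimately have "q (1 / d) < 0" by (intro e(2)) auto
    then show "F1 r l1 l2 b1 b2 v1 v2 d < 0"
      using \<open>d \<noteq> 0\<close> by (simp add: F1_q mult_pos_neg)
  qed (use e in simp)
qed

lemma F1_differentiable: "F1 r l1 l2 b1 b2 v1 v2 differentiable (at d)"
  unfolding F1_def[abs_def] power2_abs by (intro derivative_intros)

lemma F1_continuous_on: "continuous_on S (F1 r l1 l2 b1 b2 v1 v2)"
  unfolding F1_def[abs_def] by (intro continuous_intros)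

lemma F1_rolle:
  assumes "d < e" "F1 r l1 l2 b1 b2 v1 v2 d = F1 r l1 l2 b1 b2 v1 v2 e"
  obtains z where "d < z" "z < e" "deriv (F1 r l1 l2 b1 b2 v1 v2) z = 0"
  using Rolle[OF assms F1_continuous_on] F1_differentiable DERIV_imp_deriv by metis

section \<open>Mode-by-mode solution of the equilibrium equation\<close>

locale shifted_two_modes =
  fixes M :: "real ^2 ^2" and c v1 v2 :: "real ^2" and l1 l2 b1 b2 :: real
  assumes eig1: "eigenvector M v1 l1" and eig2: "eigenvector M v2 l2"
    and order: "l1 < l2" "l2 < 0" and unit: "norm v1 = 1" "norm v2 = 1"
    and c_eq: "c = b1 *\<^sub>R v1 + b2 *\<^sub>R v2"
    and c_not_eigenvector: "\<not> (\<exists>k. eigenvector M c k)" and c_nz: "c \<noteq> 0"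
begin

abbreviation w where "w \<equiv> v1 \<bullet> v2"

text \<open>\<open>Y \<delta>\<close> is the only possible position, relative to \<open>c\<close>, of an equilibrium with indicator \<open>\<delta>\<close>.\<close>

definition c1 where "c1 \<delta> = l1 / (l1 - 2 * \<delta>) * b1"
definition c2 where "c2 \<delta> = l2 / (l2 - 2 * \<delta>) * b2"
definition Y where "Y \<delta> = - (c1 \<delta> *\<^sub>R v1 + c2 \<delta> *\<^sub>R v2)"

lemma M_v: "M *v v1 = l1 *\<^sub>R v1" "M *v v2 = l2 *\<^sub>R v2"
  using eig1 eig2 by (simp_all add: eigenvector_def scalar_mult_eq_scaleR)

lemma eigenvalues: "eigenvalue M l1" "eigenvalue M l2"
  using eig1 eig2 by (auto simp: eigenvalue_def)

text \<open>Otherwise \<open>c\<close> would be an eigenvector for \<open>l2\<close>. This is what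
  makes \<open>F1\<close> positive at \<open>l1 / 2\<close>.\<close>

lemma b1_nz: "b1 \<noteq> 0"
proof
  assume "b1 = 0"
  then have "eigenvector M c l2"
    using c_nz c_eq M_v
    by (simp add: eigenvector_def scalar_mult_eq_scaleR matrix_vector_mult_scaleR)
  then show False using c_not_eigenvector by blast
qed

lemma indicator_nonresonant:
  assumes "M *v p = (2 * \<delta>) *\<^sub>R (p - c)"
  shows "\<delta> \<noteq> l1 / 2" "\<delta> \<noteq> l2 / 2"
  using eigenvector_of_resonant_shift[of M l1 l2 c p] eigenvector_of_resonant_shift[of M l2 l1 c p]
    assms order c_not_eigenvector c_nz eigenvalues by auto

text \<open>Along each eigenvector the equation decouples into
  \<open>l * (b - c) = - 2 * \<delta> * c\<close> for scalars, which \<open>c1 \<delta>\<close> and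
  \<open>c2 \<delta>\<close> solve.\<close>

lemma M_Y:
  assumes "\<delta> \<noteq> l1 / 2" "\<delta> \<noteq> l2 / 2"
  shows "M *v (c + Y \<delta>) = (2 * \<delta>) *\<^sub>R Y \<delta>"
proof -
  have e: "l1 * b1 - l1 * c1 \<delta> = - (2 * \<delta> * c1 \<delta>)" "l2 * b2 - l2 * c2 \<delta> = - (2 * \<delta> * c2 \<delta>)"
    using assms by (simp_all add: c1_def c2_def field_simps)
  have "M *v (c + Y \<delta>) = (l1 * b1 - l1 * c1 \<delta>) *\<^sub>R v1 + (l2 * b2 - l2 * c2 \<delta>) *\<^sub>R v2"
    unfolding c_eq Y_def
    by (simp add: matrix_vector_right_distrib matrix_vector_mult_diff_distrib
        matrix_vector_mult_scaleR M_v algebra_simps)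
  then show ?thesis unfolding e by (simp add: Y_def algebra_simps)
qed

text \<open>Two solutions differ by a vector in the kernel of \<open>M - 2 * \<delta>\<close>. If it
  were nonzero, \<open>2 * \<delta>\<close> would be a third eigenvalue, against the trace.\<close>

lemma equilibrium_eq_Y:
  assumes p: "M *v p = (2 * \<delta>) *\<^sub>R (p - c)"
  shows "p - c = Y \<delta>"
proof (rule ccontr)
  note nr = indicator_nonresonant[OF p]
  define z where "z = p - (c + Y \<delta>)"
  assume "p - c \<noteq> Y \<delta>"
  then have "z \<noteq> 0" by (auto simp: z_def algebra_simps)
  moreover have "M *v z = (2 * \<delta>) *\<^sub>R z"
    unfolding z_def matrix_vector_mult_diff_distrib p M_Y[OF nr] by (simp add: algebra_simps)
  ultimately have "eigenvalue M (2 * \<delta>)"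
    by (auto simp: eigenvalue_def eigenvector_def scalar_mult_eq_scaleR)
  then have "trace M = l1 + 2 * \<delta>"
    using trace_2_eq_sum_eigenvalues[of M l1 "2 * \<delta>"] eigenvalues nr by auto
  moreover have "trace M = l1 + l2"
    using trace_2_eq_sum_eigenvalues[of M l1 l2] eigenvalues order by auto
  ultimately show False using nr by simp
qed

lemma norm_Y: "Y \<delta> \<bullet> Y \<delta> = c1 \<delta> * (c1 \<delta> + c2 \<delta> * w) + c2 \<delta> * (c2 \<delta> + c1 \<delta> * w)"
  using unit unfolding Y_def norm_eq_1
  by (simp add: inner_add_left inner_add_right inner_commute[of v2 v1] algebra_simps)

text \<open>\<open>F1\<close> is the equation \<open>norm (Y \<delta>) = r\<close>, squared and
  cleared of denominators; away from resonance its roots are exactly the values that put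
  \<open>Y \<delta>\<close> on the circle.\<close>

lemma F1_eq:
  assumes "\<delta> \<noteq> l1 / 2" "\<delta> \<noteq> l2 / 2"
  shows "F1 r l1 l2 b1 b2 v1 v2 \<delta> =
    (l1 - 2 * \<delta>)^2 * (l2 - 2 * \<delta>)^2 * (Y \<delta> \<bullet> Y \<delta> - r^2)"
proof -
  have e: "l1 * b1 = (l1 - 2 * \<delta>) * c1 \<delta>" "l2 * b2 = (l2 - 2 * \<delta>) * c2 \<delta>"
    using assms by (simp_all add: c1_def c2_def)
  have "F1 r l1 l2 b1 b2 v1 v2 \<delta> = - ((l1 - 2 * \<delta>)^2 * (l2 - 2 * \<delta>)^2 * r^2)
     + (l1 * b1)^2 * (l2 - 2 * \<delta>)^2 + (l2 * b2)^2 * (l1 - 2 * \<delta>)^2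
     + 2 * ((l1 * b1) * (l2 * b2) * (l2 - 2 * \<delta>) * (l1 - 2 * \<delta>) * w)"
    unfolding F1_def power2_abs by (simp add: inner_commute[of v2 v1])
  also have "\<dots> = (l1 - 2 * \<delta>)^2 * (l2 - 2 * \<delta>)^2 * (Y \<delta> \<bullet> Y \<delta> - r^2)"
    unfolding e norm_Y by algebra
  finally show ?thesis .
qed

text \<open>By the trace identity the tangential entry is the trace minus the normal entry, so each
  summand of \<open>norm_Y\<close> ends up weighted by the rate of the other mode.\<close>

lemma tangential_rate:
  assumes "Y \<delta> \<noteq> 0"
  shows "(perp (Y \<delta>) \<bullet> (M *v perp (Y \<delta>)) / (Y \<delta> \<bullet> Y \<delta>) - 2 * \<delta>) * (Y \<delta> \<bullet> Y \<delta>) =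
    (l2 - 2 * \<delta>) * (c1 \<delta> * (c1 \<delta> + c2 \<delta> * w)) + (l1 - 2 * \<delta>) * (c2 \<delta> * (c2 \<delta> + c1 \<delta> * w))"
    (is "?\<mu> * _ = _")
proof -
  have "?\<mu> * (Y \<delta> \<bullet> Y \<delta>) = perp (Y \<delta>) \<bullet> (M *v perp (Y \<delta>)) - 2 * \<delta> * (Y \<delta> \<bullet> Y \<delta>)"
    using assms by (simp add: left_diff_distrib)
  also have "\<dots> = (l1 + l2 - 2 * \<delta>) * (Y \<delta> \<bullet> Y \<delta>) - Y \<delta> \<bullet> (M *v Y \<delta>)"
    using trace_perp[of "Y \<delta>" M] trace_2_eq_sum_eigenvalues[OF eigenvalues] order
    by (simp add: algebra_simps)
  also have "Y \<delta> \<bullet> (M *v Y \<delta>) =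
      l1 * (c1 \<delta>)^2 + l2 * (c2 \<delta>)^2 + (l1 + l2) * (c1 \<delta> * c2 \<delta> * w)"
  proof -
    have MY: "M *v Y \<delta> = - ((c1 \<delta> * l1) *\<^sub>R v1 + (c2 \<delta> * l2) *\<^sub>R v2)"
    proof -
      have "Y \<delta> = (- c1 \<delta>) *\<^sub>R v1 + (- c2 \<delta>) *\<^sub>R v2" by (simp add: Y_def)
      then show ?thesis
        by (simp only: matrix_vector_right_distrib matrix_vector_mult_scaleR M_v) simp
    qed
    then show ?thesis
      using unit unfolding MY unfolding Y_def norm_eq_1
      by (simp add: inner_add_left inner_add_right inner_diff_left inner_diff_right
          inner_commute[of v2 v1] power2_eq_square algebra_simps)
  qed
  finally show ?thesis unfolding norm_Y by (simp add: power2_eq_square algebra_simps)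
qed

text \<open>The summand with \<open>c1 \<delta>\<close> in front is nonnegative, so lowering its
  weight from \<open>l2 - 2 * \<delta>\<close> to \<open>l1 - 2 * \<delta>\<close> leaves the lower
  bound \<open>(l1 - 2 * \<delta>) * (Y \<delta> \<bullet> Y \<delta>)\<close>.\<close>

lemma tangential_rate_pos:
  assumes \<delta>: "\<delta> < l1 / 2" and b: "b1^2 + b1 * b2 * w \<ge> 0" and Y: "Y \<delta> \<noteq> 0"
  shows "perp (Y \<delta>) \<bullet> (M *v perp (Y \<delta>)) / (Y \<delta> \<bullet> Y \<delta>) - 2 * \<delta> > 0" (is "?\<mu> > 0")
proof -
  have pos: "0 < l1 - 2 * \<delta>" "0 < l2 - 2 * \<delta>" "\<delta> < 0" using \<delta> order by auto
  have "l1 / (l1 - 2 * \<delta>) * (l2 / (l2 - 2 * \<delta>)) \<ge> 0"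
    using pos order by (intro mult_nonpos_nonpos divide_nonpos_pos) auto
  \<comment> \<open>For negative \<open>\<delta>\<close>, \<open>l / (l - 2 * \<delta>)\<close>
    increases in \<open>l\<close> on either side of its pole, and \<open>l1\<close>,
    \<open>l2\<close> lie on the same side.\<close>
  moreover have "l1 / (l1 - 2 * \<delta>) \<le> l2 / (l2 - 2 * \<delta>)"
    using pos order by (simp add: field_simps)
  ultimately have nn: "c1 \<delta> * (c1 \<delta> + c2 \<delta> * w) \<ge> 0"
    unfolding c1_def c2_def using pos order
    by (intro weighted_projection_nonneg b mult_nonpos_nonpos) (auto intro: divide_nonpos_pos)
  have "0 < (l1 - 2 * \<delta>) * (Y \<delta> \<bullet> Y \<delta>)" using pos Y by simp
  also have "\<dots> = (l1 - 2 * \<delta>) * (c1 \<delta> * (c1 \<delta> + c2 \<delta> * w)) +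
      (l1 - 2 * \<delta>) * (c2 \<delta> * (c2 \<delta> + c1 \<delta> * w))"
    unfolding norm_Y by (rule distrib_left)
  also have "\<dots> \<le> ?\<mu> * (Y \<delta> \<bullet> Y \<delta>)"
    unfolding tangential_rate[OF Y]
    using order by (intro add_right_mono mult_right_mono nn) auto
  finally show ?thesis by (rule zero_less_mult_pos2) (use Y in simp)
qed

text \<open>Mirror image: here the summand with \<open>c2 \<delta>\<close> in front is nonnegative,
  and raising its weight to \<open>l2 - 2 * \<delta>\<close> gives a negative upper bound.\<close>

lemma tangential_rate_neg:
  assumes \<delta>: "l2 / 2 < \<delta>" "\<delta> < 0" and b: "b2^2 + b1 * b2 * w \<ge> 0" and Y: "Y \<delta> \<noteq> 0"
  shows "perp (Y \<delta>) \<bullet> (M *v perp (Y \<delta>)) / (Y \<delta> \<bullet> Y \<delta>) - 2 * \<delta> < 0" (is "?\<mu> < 0")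
proof -
  have neg: "l1 - 2 * \<delta> < 0" "l2 - 2 * \<delta> < 0" using \<delta> order by auto
  have "l2 / (l2 - 2 * \<delta>) * (l1 / (l1 - 2 * \<delta>)) \<ge> 0"
    using neg order by (intro mult_nonneg_nonneg divide_nonpos_neg) auto
  moreover have "l1 / (l1 - 2 * \<delta>) \<le> l2 / (l2 - 2 * \<delta>)"
    using neg order \<delta> by (simp add: field_simps)
  ultimately have nn: "c2 \<delta> * (c2 \<delta> + c1 \<delta> * w) \<ge> 0"
    unfolding c1_def c2_def using neg order b
    by (intro weighted_projection_nonneg mult_nonneg_nonneg)
      (auto intro: divide_nonpos_neg simp: mult.commute)
  have "?\<mu> * (Y \<delta> \<bullet> Y \<delta>) \<le> (l2 - 2 * \<delta>) * (c1 \<delta> * (c1 \<delta> + c2 \<delta> * w)) +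
      (l2 - 2 * \<delta>) * (c2 \<delta> * (c2 \<delta> + c1 \<delta> * w))"
    unfolding tangential_rate[OF Y]
    using order by (intro add_left_mono mult_right_mono nn) auto
  also have "\<dots> = (l2 - 2 * \<delta>) * (Y \<delta> \<bullet> Y \<delta>)"
    unfolding norm_Y by (rule distrib_left[symmetric])
  also have "\<dots> < 0" using neg Y by (simp add: mult_neg_pos)
  finally show ?thesis by (meson inner_ge_zero linorder_not_le mult_nonneg_nonneg)
qed

lemma F1_unique_negative_root:
  assumes r: "r > 0" "norm c > r" and crit: "\<exists>!\<delta>. deriv (F1 r l1 l2 b1 b2 v1 v2) \<delta> = 0"
  obtains d where "d < l1 / 2" "F1 r l1 l2 b1 b2 v1 v2 d = 0"
    "\<And>\<delta>. \<delta> < 0 \<Longrightarrow> F1 r l1 l2 b1 b2 v1 v2 \<delta> = 0 \<Longrightarrow> \<delta> = d"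
proof -
  let ?F = "F1 r l1 l2 b1 b2 v1 v2"
  obtain R where R: "R > 0" "\<And>d. \<bar>d\<bar> > R \<Longrightarrow> ?F d < 0"
    using F1_at_infinity_neg[OF r(1), of l1 l2 b1 b2 v1 v2] by blast
  \<comment> \<open>Only the term without a factor \<open>l1 - 2 * \<delta>\<close> survives, namely
    the square of \<open>l1 * b1 * (l2 - l1)\<close>.\<close>
  have F_l1: "?F (l1 / 2) > 0"
    using b1_nz order by (simp add: F1_def)
  \<comment> \<open>At 0 the sign of \<open>F1\<close> is that of \<open>(norm c)^2 - r^2\<close>:
    the origin lies outside the ball.\<close>
  have "Y 0 = - c" using order by (simp add: Y_def c1_def c2_def c_eq)
  then have F_0: "?F 0 > 0"
    using F1_eq[of 0 r] order r by (simp add: dot_square_norm power_strict_mono)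
  \<comment> \<open>As \<open>l1 < 0\<close>, the point \<open>l1 - R\<close> lies to the left of
    both \<open>- R\<close> and \<open>l1 / 2\<close>.\<close>
  obtain d where d: "d \<le> l1 / 2" "?F d = 0"
    using IVT'[of ?F "l1 - R" 0 "l1 / 2", OF _ _ _ F1_continuous_on] R(1) R(2)[of "l1 - R"] F_l1 order
    by auto
  obtain e where e: "0 \<le> e" "?F e = 0"
    using IVT2'[of ?F "R + 1" 0 0, OF _ _ _ F1_continuous_on] R(1) R(2)[of "R + 1"] F_0
    by auto
  \<comment> \<open>Together with the root \<open>e \<ge> 0\<close>, two negative roots would give two critical points.\<close>
  have two_roots: False if roots: "\<delta> < \<delta>'" "\<delta>' < 0" "?F \<delta> = 0" "?F \<delta>' = 0" for \<delta> \<delta>'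
  proof -
    obtain z where z: "z < \<delta>'" "deriv ?F z = 0"
      using F1_rolle[of \<delta> \<delta>' r l1 l2 b1 b2 v1 v2] roots by auto
    obtain z' where z': "\<delta>' < z'" "deriv ?F z' = 0"
      using F1_rolle[of \<delta>' e r l1 l2 b1 b2 v1 v2] roots e by auto
    have "z = z'" using crit z(2) z'(2) by blast
    then show False using z z' by simp
  qed
  show thesis
  proof (rule that)
    show "d < l1 / 2" using d F_l1 by (metis less_irrefl order_le_imp_less_or_eq)
    show "\<delta> = d" if "\<delta> < 0" "?F \<delta> = 0" for \<delta>
      using two_roots[of \<delta> d] two_roots[of d \<delta>] that d order by (cases \<delta> d rule: linorder_cases) auto
  qed (rule d)
qed

end

section \<open>Transfer to the filtered system\<close>

theorem proposition5p14:
  fixes A B K At :: "real ^2 ^2" and G :: "real ^2 \<Rightarrow> real ^2 ^2"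
    and h :: "real ^2 \<Rightarrow> real" and xc :: "real ^2"
    and r l1 l2 :: real and \<alpha> :: "real \<Rightarrow> real"
  defines "At \<equiv> A - B ** K"
    and "G \<equiv> \<lambda>x. transpose B ** B"
    and "h \<equiv> \<lambda>x. (norm (x - xc))^2 - r^2"
  assumes B_inv: "invertible B"
    and r_pos: "r > 0"
    and h_origin: "h 0 > 0"
    and alpha_K: "extended_class_K_inf \<alpha>"
    and alpha_diff: "\<forall>s. \<alpha> differentiable (at s)"
    and alpha_deriv: "deriv \<alpha> 0 > 0"
    and At_hurwitz: "hurwitz At"
    and eigenvalues: "eigenvalue At l1" "eigenvalue At l2" "l1 < l2"
    and xc_not_eigenvector: "\<not> (\<exists>k. eigenvector At xc k)"
  shows "\<not> (\<exists>x \<delta>. undesired_equilibrium_with_indicator At B G h x \<delta> \<and> \<delta> \<in> {l1 / 2, l2 / 2}) \<and>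
    (\<forall>v1 v2 \<beta>1 \<beta>2.
       eigenvector At v1 l1 \<and> eigenvector At v2 l2 \<and> v1 \<bullet> v2 \<ge> 0 \<and>
       norm v1 = 1 \<and> norm v2 = 1 \<and> xc = \<beta>1 *\<^sub>R v1 + \<beta>2 *\<^sub>R v2 \<longrightarrow>
       (\<beta>1^2 + \<beta>1 * \<beta>2 * (v1 \<bullet> v2) \<ge> 0 \<longrightarrow>
          (\<forall>x \<delta>. undesired_equilibrium_with_indicator At B G h x \<delta> \<and> \<delta> < l1 / 2 \<longrightarrow>
             saddle_point (filtered_system At B G h \<alpha>) x)) \<and>
       (\<beta>1 * \<beta>2 * (v2 \<bullet> v1) + \<beta>2^2 \<ge> 0 \<longrightarrow>
          (\<forall>x \<delta>. undesired_equilibrium_with_indicator At B G h x \<delta> \<and> l2 / 2 < \<delta> \<and> \<delta> < 0 \<longrightarrow>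
             asymptotically_stable (filtered_system At B G h \<alpha>) x)) \<and>
       ((\<exists>!\<delta>. deriv (F1 r l1 l2 \<beta>1 \<beta>2 v1 v2) \<delta> = 0) \<and>
        \<beta>1^2 + \<beta>1 * \<beta>2 * (v1 \<bullet> v2) \<ge> 0 \<longrightarrow>
          (\<exists>x. undesired_equilibrium At B G h x \<and>
               (\<forall>y. undesired_equilibrium At B G h y \<longrightarrow> y = x) \<and>
               saddle_point (filtered_system At B G h \<alpha>) x)))"
proof -
  have l: "l1 < 0" "l2 < 0"
    using hurwitz_real_eigenvalue_neg[OF At_hurwitz] eigenvalues by auto
  have xc: "norm xc > r"
    using h_origin r_pos by (simp add: h_def power2_less_imp_less)
  then have xc_nz: "xc \<noteq> 0" using r_pos by auto
  have ue: "undesired_equilibrium_with_indicator At B G h x \<delta> \<longleftrightarrow>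
      norm (x - xc) = r \<and> \<delta> < 0 \<and> At *v x = (2 * \<delta>) *\<^sub>R (x - xc)" for x \<delta>
    unfolding G_def h_def by (rule ball_undesired_equilibrium_iff[OF B_inv r_pos])
  have \<alpha>0: "\<alpha> 0 = 0" using alpha_K by (simp add: extended_class_K_inf_def)
  have linearization: "\<exists>J. planar_linearization (filtered_system At B G h \<alpha>) x J (x - xc) (deriv \<alpha> 0)
      ((perp (x - xc) \<bullet> (At *v perp (x - xc))) / r^2 - 2 * \<delta>)"
    if "undesired_equilibrium_with_indicator At B G h x \<delta>" for x \<delta>
    using that ball_filter_linearization[OF B_inv r_pos \<alpha>0 _ alpha_deriv, of x xc \<delta> At] alpha_diff
    unfolding ue unfolding G_def h_def by blast
  \<comment> \<open>Resonance is excluded from the eigenvalues alone, since the first claim is made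
    before any eigenvectors are fixed.\<close>
  have "At *v x \<noteq> l1 *\<^sub>R (x - xc)" "At *v x \<noteq> l2 *\<^sub>R (x - xc)" for x
    using eigenvector_of_resonant_shift[OF eigenvalues(1,2), of xc x]
      eigenvector_of_resonant_shift[OF eigenvalues(2,1), of xc x]
      eigenvalues(3) l xc_nz xc_not_eigenvector
    by auto
  then have nonresonant: "2 * \<delta> \<noteq> l1 \<and> 2 * \<delta> \<noteq> l2" if "At *v x = (2 * \<delta>) *\<^sub>R (x - xc)" for x \<delta>
    using that by metis
  have "\<not> (\<exists>x \<delta>. undesired_equilibrium_with_indicator At B G h x \<delta> \<and> \<delta> \<in> {l1 / 2, l2 / 2})"
  proof (intro notI, elim exE conjE)
    fix x \<delta> assume "undesired_equilibrium_with_indicator At B G h x \<delta>" "\<delta> \<in> {l1 / 2, l2 / 2}"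
    then show False using nonresonant[of x \<delta>] by (auto simp: ue)
  qed
  moreover {
    fix v1 v2 \<beta>1 \<beta>2
    assume v: "eigenvector At v1 l1 \<and> eigenvector At v2 l2 \<and> v1 \<bullet> v2 \<ge> 0 \<and>
       norm v1 = 1 \<and> norm v2 = 1 \<and> xc = \<beta>1 *\<^sub>R v1 + \<beta>2 *\<^sub>R v2"
    interpret shifted_two_modes At xc v1 v2 l1 l2 \<beta>1 \<beta>2
      using v l eigenvalues(3) xc_nz xc_not_eigenvector by unfold_locales auto
    \<comment> \<open>The last identity matches the denominator \<open>r^2\<close> of the
      linearization with the one in the tangential rate.\<close>
    have Y: "x - xc = Y \<delta>" "Y \<delta> \<noteq> 0" "Y \<delta> \<bullet> Y \<delta> = r^2"
      if "undesired_equilibrium_with_indicator At B G h x \<delta>" for x \<delta>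
    proof -
      show "x - xc = Y \<delta>" using that equilibrium_eq_Y by (auto simp: ue)
      then show "Y \<delta> \<bullet> Y \<delta> = r^2" using that by (simp add: ue dot_square_norm)
      then show "Y \<delta> \<noteq> 0" using r_pos by auto
    qed
    have saddle: "saddle_point (filtered_system At B G h \<alpha>) x"
      if b: "\<beta>1^2 + \<beta>1 * \<beta>2 * (v1 \<bullet> v2) \<ge> 0"
        and x: "undesired_equilibrium_with_indicator At B G h x \<delta>" "\<delta> < l1 / 2" for x \<delta>
      using linearization[OF x(1)] tangential_rate_pos[OF x(2) b Y(2)[OF x(1)]]
      unfolding Y(1)[OF x(1)] Y(3)[OF x(1)]
      by (auto intro: planar_linearization.saddle_pointI)
    have stable: "asymptotically_stable (filtered_system At B G h \<alpha>) x"
      if b: "\<beta>1 * \<beta>2 * (v2 \<bullet> v1) + \<beta>2^2 \<ge> 0"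
        and x: "undesired_equilibrium_with_indicator At B G h x \<delta>" "l2 / 2 < \<delta>" "\<delta> < 0" for x \<delta>
    proof -
      have "\<beta>2^2 + \<beta>1 * \<beta>2 * (v1 \<bullet> v2) \<ge> 0" using b by (simp add: inner_commute add.commute)
      from linearization[OF x(1)] tangential_rate_neg[OF x(2,3) this Y(2)[OF x(1)]] show ?thesis
        unfolding Y(1)[OF x(1)] Y(3)[OF x(1)]
        by (auto intro: planar_linearization.asymptotically_stableI)
    qed
    have unique: "\<exists>x. undesired_equilibrium At B G h x \<and>
        (\<forall>y. undesired_equilibrium At B G h y \<longrightarrow> y = x) \<and>
        saddle_point (filtered_system At B G h \<alpha>) x"
      if crit: "\<exists>!\<delta>. deriv (F1 r l1 l2 \<beta>1 \<beta>2 v1 v2) \<delta> = 0"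
        and b: "\<beta>1^2 + \<beta>1 * \<beta>2 * (v1 \<bullet> v2) \<ge> 0"
    proof -
      obtain d where d: "d < l1 / 2" "F1 r l1 l2 \<beta>1 \<beta>2 v1 v2 d = 0"
        and uniq: "\<And>\<delta>. \<delta> < 0 \<Longrightarrow> F1 r l1 l2 \<beta>1 \<beta>2 v1 v2 \<delta> = 0 \<Longrightarrow> \<delta> = d"
        using F1_unique_negative_root[OF r_pos xc crit] by metis
      have nr: "d \<noteq> l1 / 2" "d \<noteq> l2 / 2" using d order(1) by auto
      \<comment> \<open>The squared factors in \<open>F1_eq\<close> are nonzero at \<open>d\<close>,
        so the root places \<open>xc + Y d\<close> on the boundary circle.\<close>
      have "Y d \<bullet> Y d = r^2" using F1_eq[OF nr, of r] d(2) nr by auto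
      then have "norm (Y d) = r" using r_pos by (simp add: norm_eq_sqrt_inner)
      then have x: "undesired_equilibrium_with_indicator At B G h (xc + Y d) d"
        using M_Y[OF nr] d l by (simp add: ue)
      \<comment> \<open>The indicator of any undesired equilibrium is a negative root of
        \<open>F1\<close>, hence equal to \<open>d\<close>, and the indicator determines the
        point.\<close>
      have "y = xc + Y d" if "undesired_equilibrium_with_indicator At B G h y \<delta>" for y \<delta>
      proof -
        have \<delta>: "\<delta> < 0" "At *v y = (2 * \<delta>) *\<^sub>R (y - xc)" using that by (auto simp: ue)
        then have "F1 r l1 l2 \<beta>1 \<beta>2 v1 v2 \<delta> = 0"
          using F1_eq[OF indicator_nonresonant[OF \<delta>(2)], of r] Y(3)[OF that] by simp
        then have "\<delta> = d" using uniq \<delta>(1) by blast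
        then show ?thesis using Y(1)[OF that] by (simp add: algebra_simps)
      qed
      then show ?thesis
        using x saddle[OF b x d(1)] unfolding undesired_equilibrium_def by blast
    qed
    note saddle stable unique
  }
  ultimately show ?thesis by blast
qed

end
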